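(* Let $p>0$ and $q\ge 0$. Let $B$ be the heterogeneous network with $M=2$ nodes, external rates $p_1=2p$, $p_2=0$, and internal rates $q_{2,1}=0$ (influence of node 2 on node 1) and $q_{1,2}=2q$ (influence of node 1 on node 2). Let $A$ be the homogeneous network with $M=2$ nodes, $p_1=p_2=p$ and $q_{1,2}=q_{2,1}=q$. Let $f^A(t),f^B(t)$ be the expected fractions of adopters in $A$ and $B$. Then for all $0<t<\infty$, $$\begin{cases} f^B(t)>f^A(t), & \text{if } q>p,\\ f^B(t)=f^A(t), & \text{if } q=p,\\ f^B(t)<f^A(t), & \text{if } q<p.\end{cases}$$
   Context: Discrete Bass model: a network has $M$ nodes, external rates $p_j\ge 0$ and internal rates $q_{i,j}\ge 0$ ($i\ne j$; the influence of $i$ on $j$). $X_j(t)\in\{0,1\}$ is the state of node $j$ ($1$ = adopter), $X_j(0)=0$ for all $j$. The process $(X_1,\dots,X_M)$ is a continuous-time Markov chain in which adopters remain adopters forever, and each nonadopter $j$ becomes an adopter at rate $p_j+\sum_{k\ne j}q_{k,j}X_k(t)$ (one node changes at a time). The expected fraction of adopters is $f(t)=\frac1M\,\mathbf{E}\big[\sum_{j=1}^M X_j(t)\big]$. *)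

theory Defs
  imports "HOL-Probability.Probability"
begin

text \<open>
  A time-homogeneous continuous-time Markov chain \<open>Y\<close> on \<open>S\<close> with infinitesimal generator \<open>G\<close>
  (intended for finite \<open>S\<close>). Only times \<open>t \<ge> 0\<close> matter. Conditional probabilities are constrained
  only where the conditioning event has positive probability (\<open>cond_prob\<close> is \<open>0\<close> otherwise).
  At \<open>h = 0\<close> the function differentiated in \<open>transition_rates\<close> is the Kronecker delta, so that
  assumption says \<open>P(Y(t+h) = y | Y(t) = x) = \<delta> x y + G x y h + o(h)\<close> as \<open>h\<close> decreases to \<open>0\<close>.
\<close>

locale ctmc = prob_space \<Omega> for \<Omega> :: "'w measure" +
  fixes S :: "'s set"
    and G :: "'s \<Rightarrow> 's \<Rightarrow> real"
    and Y :: "real \<Rightarrow> 'w \<Rightarrow> 's"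
  assumes measurable_state: "\<And>t. 0 \<le> t \<Longrightarrow> Y t \<in> measurable \<Omega> (count_space S)"
    and markov_property:
      "\<And>s h T z x y. \<lbrakk>0 \<le> s; 0 \<le> h; finite T; T \<subseteq> {0..<s}; x \<in> S; y \<in> S;
          \<P>(\<omega> in \<Omega>. Y s \<omega> = x \<and> (\<forall>r\<in>T. Y r \<omega> = z r)) > 0\<rbrakk> \<Longrightarrow>
        \<P>(\<omega> in \<Omega>. Y (s + h) \<omega> = y \<bar> Y s \<omega> = x \<and> (\<forall>r\<in>T. Y r \<omega> = z r)) =
        \<P>(\<omega> in \<Omega>. Y (s + h) \<omega> = y \<bar> Y s \<omega> = x)"
    and time_homogeneous:
      "\<And>s t h x y. \<lbrakk>0 \<le> s; 0 \<le> t; 0 \<le> h; x \<in> S; y \<in> S;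
          \<P>(\<omega> in \<Omega>. Y s \<omega> = x) > 0; \<P>(\<omega> in \<Omega>. Y t \<omega> = x) > 0\<rbrakk> \<Longrightarrow>
        \<P>(\<omega> in \<Omega>. Y (s + h) \<omega> = y \<bar> Y s \<omega> = x) =
        \<P>(\<omega> in \<Omega>. Y (t + h) \<omega> = y \<bar> Y t \<omega> = x)"
    and transition_rates:
      "\<And>t x y. \<lbrakk>0 \<le> t; x \<in> S; y \<in> S; \<P>(\<omega> in \<Omega>. Y t \<omega> = x) > 0\<rbrakk> \<Longrightarrow>
        ((\<lambda>h. \<P>(\<omega> in \<Omega>. Y (t + h) \<omega> = y \<bar> Y t \<omega> = x)) has_real_derivative G x y)
          (at_right 0)"

text \<open>
  Nodes are \<open>1, \<dots>, M\<close>; \<open>q k j\<close> is the influence of \<open>k\<close> on \<open>j\<close>, and diagonal values of \<open>q\<close> are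
  never used. Configurations are extensional functions, so that two configurations are equal
  iff they agree on all nodes.
\<close>

definition bass_states :: "nat \<Rightarrow> (nat \<Rightarrow> nat) set" where
  "bass_states M = {1..M} \<rightarrow>\<^sub>E {0, 1}"

definition adoption_rate ::
    "nat \<Rightarrow> (nat \<Rightarrow> real) \<Rightarrow> (nat \<Rightarrow> nat \<Rightarrow> real) \<Rightarrow> (nat \<Rightarrow> nat) \<Rightarrow> nat \<Rightarrow> real" where
  "adoption_rate M p q x j = p j + (\<Sum>k\<in>{1..M} - {j}. q k j * real (x k))"

text \<open>For \<open>y \<noteq> x\<close> the sum has at most one term: the node whose adoption turns \<open>x\<close> into \<open>y\<close>.\<close>

definition bass_generator ::
    "nat \<Rightarrow> (nat \<Rightarrow> real) \<Rightarrow> (nat \<Rightarrow> nat \<Rightarrow> real) \<Rightarrow> (nat \<Rightarrow> nat) \<Rightarrow> (nat \<Rightarrow> nat) \<Rightarrow> real" where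
  "bass_generator M p q x y =
    (if y = x then - (\<Sum>j | j \<in> {1..M} \<and> x j = 0. adoption_rate M p q x j)
     else (\<Sum>j | j \<in> {1..M} \<and> x j = 0 \<and> y = x(j := 1). adoption_rate M p q x j))"

locale bass_model =
  ctmc \<Omega> "bass_states M" "bass_generator M p q" "\<lambda>t \<omega>. \<lambda>j\<in>{1..M}. X j t \<omega>"
  for \<Omega> :: "'w measure"
    and M :: nat
    and p :: "nat \<Rightarrow> real"
    and q :: "nat \<Rightarrow> nat \<Rightarrow> real"
    and X :: "nat \<Rightarrow> real \<Rightarrow> 'w \<Rightarrow> nat" +
  assumes nodes_nonempty: "0 < M"
    and external_rates_nonneg: "\<And>j. j \<in> {1..M} \<Longrightarrow> 0 \<le> p j"
    and internal_rates_nonneg: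
      "\<And>i j. \<lbrakk>i \<in> {1..M}; j \<in> {1..M}; i \<noteq> j\<rbrakk> \<Longrightarrow> 0 \<le> q i j"
    and initially_nonadopters: "AE \<omega> in \<Omega>. \<forall>j\<in>{1..M}. X j 0 \<omega> = 0"
    and adopters_remain:
      "AE \<omega> in \<Omega>. \<forall>j\<in>{1..M}. \<forall>s t. 0 \<le> s \<longrightarrow> s \<le> t \<longrightarrow> X j s \<omega> = 1 \<longrightarrow> X j t \<omega> = 1"

definition expected_fraction ::
    "'w measure \<Rightarrow> nat \<Rightarrow> (nat \<Rightarrow> real \<Rightarrow> 'w \<Rightarrow> nat) \<Rightarrow> real \<Rightarrow> real" where
  "expected_fraction \<Omega> M X t =
    1 / real M * prob_space.expectation \<Omega> (\<lambda>\<omega>. \<Sum>j\<in>{1..M}. real (X j t \<omega>))"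

end

theory Submission imports Defs begin

text \<open>
  By the forward equations, in both networks no node has adopted by time \<open>t\<close> with probability
  \<open>exp (- 2 * p * t)\<close>. Let \<open>S\<close> and \<open>R\<close> be the probabilities of exactly one adopter in \<open>A\<close> and
  \<open>B\<close>. Then \<open>S' = a - (p + q) * S\<close> and \<open>R' = a - 2 * q * R\<close> with \<open>a t = 2 * p * exp (- 2 * p * t)\<close>,
  so \<open>R > 0\<close> and the difference \<open>D = S - R\<close> satisfies \<open>D' = (q - p) * R - (p + q) * D\<close> with
  \<open>D 0 = 0\<close>. Hence \<open>D\<close>, which is twice the difference of the expected fractions, has the sign of
  \<open>q - p\<close>.
\<close>

section \<open>Transition probabilities and forward equations of a chain with finitely many
  states\<close>

context ctmc
begin

definition state_prob :: "'s \<Rightarrow> real \<Rightarrow> real" where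
  "state_prob x t = \<P>(\<omega> in \<Omega>. Y t \<omega> = x)"

definition reachable :: "'s set" where
  "reachable = {x \<in> S. \<exists>s\<ge>0. state_prob x s > 0}"

text \<open>Conditioning on a null event gives the value 0, so the transition probability from
  \<open>x\<close> is read off at a time when \<open>x\<close> has positive probability. Such a time
  exists for \<open>x\<close> in \<open>reachable\<close>, and by time homogeneity any such time
  gives the same value (\<open>trans_prob_eq\<close>).\<close>

definition trans_prob :: "real \<Rightarrow> 's \<Rightarrow> 's \<Rightarrow> real" where
  "trans_prob h x y =
    (let s = SOME s. 0 \<le> s \<and> state_prob x s > 0 in \<P>(\<omega> in \<Omega>. Y (s + h) \<omega> = y \<bar> Y s \<omega> = x))"

lemma state_prob_nonneg: "0 \<le> state_prob x t"
  by (simp add: state_prob_def)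

lemma state_prob_le_1: "state_prob x t \<le> 1"
  by (simp add: state_prob_def)

lemma state_in_space: "0 \<le> t \<Longrightarrow> \<omega> \<in> space \<Omega> \<Longrightarrow> Y t \<omega> \<in> S"
  using measurable_space[OF measurable_state[of t]] by simp

lemma state_event: "0 \<le> t \<Longrightarrow> x \<in> S \<Longrightarrow> {\<omega> \<in> space \<Omega>. Y t \<omega> = x} \<in> events"
proof -
  assume "0 \<le> t" "x \<in> S"
  then have "Y t -` {x} \<inter> space \<Omega> \<in> events"
    using measurable_sets[OF measurable_state[of t], of "{x}"] by simp
  also have "Y t -` {x} \<inter> space \<Omega> = {\<omega> \<in> space \<Omega>. Y t \<omega> = x}" by auto
  finally show ?thesis .
qed

lemma joint_event:
  assumes "0 \<le> s" "0 \<le> t" "x \<in> S" "y \<in> S"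
  shows "{\<omega> \<in> space \<Omega>. Y s \<omega> = x \<and> Y t \<omega> = y} \<in> events"
proof -
  have "{\<omega> \<in> space \<Omega>. Y s \<omega> = x} \<inter> {\<omega> \<in> space \<Omega>. Y t \<omega> = y} \<in> events"
    using assms by (intro sets.Int state_event)
  also have "{\<omega> \<in> space \<Omega>. Y s \<omega> = x} \<inter> {\<omega> \<in> space \<Omega>. Y t \<omega> = y}
      = {\<omega> \<in> space \<Omega>. Y s \<omega> = x \<and> Y t \<omega> = y}" by auto
  finally show ?thesis .
qed

lemma reachableI: "0 \<le> s \<Longrightarrow> x \<in> S \<Longrightarrow> state_prob x s > 0 \<Longrightarrow> x \<in> reachable"
  unfolding reachable_def by blast

lemma reachable_witness:
  assumes "x \<in> reachable"
  obtains s where "0 \<le> s" "state_prob x s > 0"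
    "\<And>h y. trans_prob h x y = \<P>(\<omega> in \<Omega>. Y (s + h) \<omega> = y \<bar> Y s \<omega> = x)"
proof
  let ?s = "SOME s. 0 \<le> s \<and> state_prob x s > 0"
  have "\<exists>s. 0 \<le> s \<and> state_prob x s > 0"
    using assms unfolding reachable_def by blast
  from someI_ex[OF this] show "0 \<le> ?s" "state_prob x ?s > 0" by simp_all
  show "\<And>h y. trans_prob h x y = \<P>(\<omega> in \<Omega>. Y (?s + h) \<omega> = y \<bar> Y ?s \<omega> = x)"
    by (simp add: trans_prob_def Let_def)
qed

lemma trans_prob_eq:
  assumes "0 \<le> t" "0 \<le> h" "x \<in> S" "y \<in> S" "state_prob x t > 0"
  shows "\<P>(\<omega> in \<Omega>. Y (t + h) \<omega> = y \<bar> Y t \<omega> = x) = trans_prob h x y"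
proof -
  obtain s where s: "0 \<le> s" "state_prob x s > 0"
    "\<And>h y. trans_prob h x y = \<P>(\<omega> in \<Omega>. Y (s + h) \<omega> = y \<bar> Y s \<omega> = x)"
    using reachable_witness reachableI[OF assms(1,3,5)] by metis
  show ?thesis
    unfolding s(3) using time_homogeneous[of t s h x y] assms s unfolding state_prob_def by blast
qed

text \<open>Split the event according to the state at time \<open>t\<close>. States that are null at
  \<open>t\<close> contribute 0 on both sides, whatever value \<open>trans_prob\<close> takes there;
  summing over \<open>reachable\<close> keeps exactly the states from which
  \<open>trans_prob\<close> has a known derivative.\<close>

lemma chapman_kolmogorov:
  assumes "finite S" "0 \<le> t" "0 \<le> h" "y \<in> S"
  shows "state_prob y (t + h) = (\<Sum>x\<in>reachable. state_prob x t * trans_prob h x y)"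
proof -
  let ?E = "\<lambda>x. {\<omega> \<in> space \<Omega>. Y (t + h) \<omega> = y \<and> Y t \<omega> = x}"
  have U: "{\<omega> \<in> space \<Omega>. Y (t + h) \<omega> = y} = (\<Union>x\<in>S. ?E x)"
    using state_in_space[OF assms(2)] by auto
  have null: "prob (?E x) = 0" if "x \<in> S" "\<not> state_prob x t > 0" for x
  proof -
    have "prob (?E x) \<le> state_prob x t"
      unfolding state_prob_def
      by (rule finite_measure_mono) (use that assms state_event[of t x] in auto)
    then show ?thesis using that(2) measure_nonneg[of \<Omega> "?E x"] by linarith
  qed
  have "state_prob y (t + h) = (\<Sum>x\<in>S. prob (?E x))"
    unfolding state_prob_def U
    by (intro finite_measure_finite_Union)
      (use assms joint_event[of "t + h" t y] in \<open>auto simp: disjoint_family_on_def\<close>)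
  also have "\<dots> = (\<Sum>x\<in>reachable. prob (?E x))"
    by (rule sum.mono_neutral_right)
      (use assms null reachableI[of t] in \<open>auto simp: reachable_def\<close>)
  also have "\<dots> = (\<Sum>x\<in>reachable. state_prob x t * trans_prob h x y)"
  proof (rule sum.cong[OF refl])
    fix x assume x: "x \<in> reachable"
    then have xS: "x \<in> S" by (simp add: reachable_def)
    show "prob (?E x) = state_prob x t * trans_prob h x y"
    proof (cases "state_prob x t > 0")
      case True
      then show ?thesis
        using trans_prob_eq[of t h x y] assms xS
        by (simp add: cond_prob_def state_prob_def field_simps)
    next
      case False
      then have 0: "state_prob x t = 0" using state_prob_nonneg[of x t] by linarith
      then show ?thesis using null[OF xS False] by simp
    qed
  qed
  finally show ?thesis .
qed

lemma trans_prob_deriv: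
  assumes "x \<in> reachable" "y \<in> S"
  shows "((\<lambda>h. trans_prob h x y) has_real_derivative G x y) (at_right 0)"
proof -
  obtain s where s: "0 \<le> s" "state_prob x s > 0"
    "\<And>h y. trans_prob h x y = \<P>(\<omega> in \<Omega>. Y (s + h) \<omega> = y \<bar> Y s \<omega> = x)"
    using reachable_witness[OF assms(1)] by metis
  show ?thesis unfolding s(3)
    using s assms by (intro transition_rates) (auto simp: state_prob_def reachable_def)
qed

lemma trans_prob_quotient:
  assumes "x \<in> reachable" "y \<in> S"
  shows "((\<lambda>h. (trans_prob h x y - trans_prob 0 x y) / h) \<longlongrightarrow> G x y) (at_right 0)"
  using trans_prob_deriv[OF assms] by (simp add: has_field_derivative_iff)

text \<open>Subtracting the case \<open>h = 0\<close> of Chapman-Kolmogorov leaves the numerators of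
  the difference quotients in \<open>trans_prob_quotient\<close>.\<close>

lemma state_prob_increment:
  assumes "finite S" "0 \<le> t" "0 \<le> h" "y \<in> S"
  shows "state_prob y (t + h) - state_prob y t =
    (\<Sum>x\<in>reachable. state_prob x t * (trans_prob h x y - trans_prob 0 x y))"
  using chapman_kolmogorov[OF assms] chapman_kolmogorov[OF assms(1,2) order_refl assms(4)]
  by (simp add: sum_subtractf right_diff_distrib)

text \<open>Left continuity comes from time homogeneity, which makes the increments of the state
  probabilities over \<open>[t, t + h]\<close> small uniformly in \<open>t\<close>.\<close>

lemma state_prob_left_continuous:
  assumes "finite S" "0 < t" "y \<in> S"
  shows "((\<lambda>h. state_prob y (t - h)) \<longlongrightarrow> state_prob y t) (at_right 0)"
proof -
  let ?b = "\<lambda>h. \<Sum>x\<in>reachable. \<bar>trans_prob h x y - trans_prob 0 x y\<bar>"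
  have "((\<lambda>h. trans_prob h x y - trans_prob 0 x y) \<longlongrightarrow> 0) (at_right 0)"
    if "x \<in> reachable" for x
    using DERIV_continuous[OF trans_prob_deriv[OF that assms(3)]]
    by (simp add: continuous_within LIM_zero)
  then have lim: "(?b \<longlongrightarrow> 0) (at_right 0)"
    by (intro tendsto_null_sum tendsto_rabs_zero)
  have "\<forall>\<^sub>F h in at_right 0. h \<in> {0<..<t}"
    using assms by (intro eventually_at_right_real)
  then have "\<forall>\<^sub>F h in at_right 0. norm (state_prob y (t - h) - state_prob y t) \<le> ?b h"
  proof (rule eventually_mono)
    fix h assume h: "h \<in> {0<..<t}"
    then have "state_prob y t - state_prob y (t - h) =
        (\<Sum>x\<in>reachable. state_prob x (t - h) * (trans_prob h x y - trans_prob 0 x y))"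
      using state_prob_increment[of "t - h" h y] assms by simp
    also have "\<bar>\<dots>\<bar> \<le> (\<Sum>x\<in>reachable. \<bar>state_prob x (t - h) * (trans_prob h x y - trans_prob 0 x y)\<bar>)"
      by (rule sum_abs)
    also have "\<dots> \<le> ?b h"
      by (intro sum_mono)
        (simp add: abs_mult mult_left_le_one_le state_prob_nonneg state_prob_le_1)
    finally show "norm (state_prob y (t - h) - state_prob y t) \<le> ?b h" by simp
  qed
  then have "((\<lambda>h. state_prob y (t - h) - state_prob y t) \<longlongrightarrow> 0) (at_right 0)"
    by (rule Lim_null_comparison) (rule lim)
  then show ?thesis by (simp add: LIM_zero_iff)
qed

lemma sum_reachable_eq:
  assumes "finite S" "0 \<le> t"
  shows "(\<Sum>x\<in>reachable. state_prob x t * c x) = (\<Sum>x\<in>S. state_prob x t * c x)"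
proof (rule sum.mono_neutral_left)
  show "\<forall>x\<in>S - reachable. state_prob x t * c x = 0"
    using reachableI[OF assms(2)] state_prob_nonneg[of _ t] by (force simp: not_less less_le)
qed (use assms in \<open>auto simp: reachable_def\<close>)

lemma forward_equation_right:
  assumes "finite S" "0 \<le> t" "y \<in> S"
  shows "((\<lambda>h. (state_prob y (t + h) - state_prob y t) / h)
    \<longlongrightarrow> (\<Sum>x\<in>S. state_prob x t * G x y)) (at_right 0)"
proof -
  have lim: "((\<lambda>h. \<Sum>x\<in>reachable. state_prob x t * ((trans_prob h x y - trans_prob 0 x y) / h))
      \<longlongrightarrow> (\<Sum>x\<in>reachable. state_prob x t * G x y)) (at_right 0)"
    by (intro tendsto_intros trans_prob_quotient assms)
  have "\<forall>\<^sub>F h in at_right 0. (0::real) < h" by (simp add: eventually_at_right_less)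
  then have "\<forall>\<^sub>F h in at_right 0.
      (\<Sum>x\<in>reachable. state_prob x t * ((trans_prob h x y - trans_prob 0 x y) / h)) =
      (state_prob y (t + h) - state_prob y t) / h"
    by (rule eventually_mono) (simp add: state_prob_increment assms sum_divide_distrib)
  from Lim_transform_eventually[OF lim this] show ?thesis
    by (simp add: sum_reachable_eq assms)
qed

text \<open>The increment over \<open>[t - h, t]\<close> has weights taken at the moving time
  \<open>t - h\<close>; left continuity sends them to the weights at \<open>t\<close>.\<close>

lemma forward_equation_left:
  assumes "finite S" "0 < t" "y \<in> S"
  shows "((\<lambda>h. (state_prob y t - state_prob y (t - h)) / h)
    \<longlongrightarrow> (\<Sum>x\<in>S. state_prob x t * G x y)) (at_right 0)"
proof -
  have lim: "((\<lambda>h. \<Sum>x\<in>reachable. state_prob x (t - h) * ((trans_prob h x y - trans_prob 0 x y) / h))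
      \<longlongrightarrow> (\<Sum>x\<in>reachable. state_prob x t * G x y)) (at_right 0)"
    by (intro tendsto_intros trans_prob_quotient state_prob_left_continuous assms)
      (auto simp: reachable_def)
  have "\<forall>\<^sub>F h in at_right 0. h \<in> {0<..<t}"
    using assms by (intro eventually_at_right_real)
  then have "\<forall>\<^sub>F h in at_right 0.
      (\<Sum>x\<in>reachable. state_prob x (t - h) * ((trans_prob h x y - trans_prob 0 x y) / h)) =
      (state_prob y t - state_prob y (t - h)) / h"
  proof (rule eventually_mono)
    fix h assume "h \<in> {0<..<t}"
    then show "(\<Sum>x\<in>reachable. state_prob x (t - h) * ((trans_prob h x y - trans_prob 0 x y) / h)) =
        (state_prob y t - state_prob y (t - h)) / h"
      using state_prob_increment[of "t - h" h y] assms by (simp add: sum_divide_distrib)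
  qed
  from Lim_transform_eventually[OF lim this] show ?thesis
    using assms by (simp add: sum_reachable_eq)
qed

lemma forward_equation:
  assumes "finite S" "0 < t" "y \<in> S"
  shows "(state_prob y has_real_derivative (\<Sum>x\<in>S. state_prob x t * G x y)) (at t)"
proof -
  let ?Q = "\<lambda>h. (state_prob y (t + h) - state_prob y t) / h"
  let ?L = "\<Sum>x\<in>S. state_prob x t * G x y"
  \<comment> \<open>Reflecting \<open>h\<close> turns the left limit of the quotient into the limit
    treated in \<open>forward_equation_left\<close>.\<close>
  have "(\<lambda>h. ?Q (- h)) = (\<lambda>h. (state_prob y t - state_prob y (t - h)) / h)"
    by (auto simp: fun_eq_iff minus_divide_left[symmetric] diff_divide_distrib)
  then have "(?Q \<longlongrightarrow> ?L) (at_left 0)"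
    using forward_equation_left[OF assms]
    by (simp add: filterlim_at_left_to_right[of _ _ 0])
  moreover have "(?Q \<longlongrightarrow> ?L) (at_right 0)"
    using assms by (intro forward_equation_right) auto
  ultimately show ?thesis
    unfolding DERIV_def by (simp add: filterlim_split_at)
qed

text \<open>This links the differential equations, valid at positive times, to the initial values.
  At 0 the right derivative gives continuity.\<close>

lemma state_prob_continuous_on:
  assumes "finite S" "y \<in> S"
  shows "continuous_on {0..} (state_prob y)"
proof -
  have "continuous (at t within {0..}) (state_prob y)" if "0 \<le> t" for t
  proof (cases "t = 0")
    case True
    have "(state_prob y has_real_derivative (\<Sum>x\<in>S. state_prob x 0 * G x y)) (at_right 0)"
      using forward_equation_right[OF assms(1) order_refl assms(2)]
      by (simp add: has_field_derivative_iff)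
    then have "continuous (at_right 0) (state_prob y)"
      by (rule DERIV_continuous)
    then show ?thesis
      using True by (simp add: continuous_within at_within_Ici_at_right)
  next
    case False
    then show ?thesis
      using forward_equation[OF assms(1) _ assms(2)] that
      by (metis DERIV_isCont continuous_at_imp_continuous_at_within order_less_le)
  qed
  then show ?thesis by (simp add: continuous_on_eq_continuous_within)
qed

end

section \<open>Scalar linear differential equations\<close>

text \<open>With the integrating factor \<open>exp (c * s)\<close> the damping term cancels: the
  product has derivative \<open>g s * exp (c * s) > 0\<close>. Continuity on the closed interval
  carries strict growth from the open interval to the starting value 0.\<close>

lemma linear_ode_pos:
  fixes u g :: "real \<Rightarrow> real"
  assumes "continuous_on {0..} u" "u 0 = 0" "0 < t"
    and deriv: "\<And>s. 0 < s \<Longrightarrow> (u has_real_derivative g s - c * u s) (at s)"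
    and pos: "\<And>s. 0 < s \<Longrightarrow> 0 < g s"
  shows "0 < u t"
proof -
  have "u 0 * exp (c * 0) < u t * exp (c * t)"
  proof (rule DERIV_pos_imp_increasing_open[OF assms(3)])
    fix s assume s: "0 < s" "s < t"
    have "((\<lambda>s. u s * exp (c * s)) has_real_derivative g s * exp (c * s)) (at s)"
      by (auto intro!: derivative_eq_intros deriv s simp: algebra_simps)
    then show "\<exists>y. ((\<lambda>s. u s * exp (c * s)) has_real_derivative y) (at s) \<and> 0 < y"
      using pos[OF s(1)] by (intro exI[of _ "g s * exp (c * s)"]) simp
  qed (intro continuous_intros continuous_on_subset[OF assms(1)], auto)
  then show ?thesis using assms(2) by (simp add: zero_less_mult_iff)
qed

text \<open>Without a source the same integrating factor makes the product constant.\<close>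

lemma linear_ode_homogeneous:
  fixes u :: "real \<Rightarrow> real"
  assumes "continuous_on {0..} u" "0 \<le> t"
    and deriv: "\<And>s. 0 < s \<Longrightarrow> (u has_real_derivative - c * u s) (at s)"
  shows "u t = u 0 * exp (- c * t)"
proof (cases "t = 0")
  case False
  then have t: "0 < t" using assms(2) by simp
  have "u t * exp (c * t) = u 0 * exp (c * 0)"
  proof (rule DERIV_isconst_end[OF t])
    fix s assume s: "0 < s" "s < t"
    show "((\<lambda>s. u s * exp (c * s)) has_real_derivative 0) (at s)"
      by (auto intro!: derivative_eq_intros deriv s simp: algebra_simps)
  qed (intro continuous_intros continuous_on_subset[OF assms(1)], auto)
  then show ?thesis by (simp add: exp_minus field_simps)
qed simp

section \<open>Configurations and generator for two nodes\<close>

text \<open>The arguments are the states of nodes 1 and 2. The restriction to \<open>{1..2}\<close>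
  makes the function extensional, as membership in \<open>bass_states 2\<close> requires.\<close>

definition config2 :: "nat \<Rightarrow> nat \<Rightarrow> nat \<Rightarrow> nat" where
  "config2 a b = (\<lambda>j\<in>{1..2}. if j = 1 then a else b)"

lemma nodes_2: "{1..2::nat} = {1, 2}"
  by auto

lemma config2_apply [simp]:
  "config2 a b 1 = a" "config2 a b (Suc 0) = a" "config2 a b 2 = b"
  by (auto simp: config2_def)

lemma config2_eq_iff [simp]: "config2 a b = config2 c d \<longleftrightarrow> a = c \<and> b = d"
proof
  assume eq: "config2 a b = config2 c d"
  show "a = c \<and> b = d"
    using fun_cong[OF eq, of 1] fun_cong[OF eq, of 2] by simp
qed simp

lemma config2_upd [simp]:
  "(config2 a b)(1 := c) = config2 c b" "(config2 a b)(Suc 0 := c) = config2 c b"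
  "(config2 a b)(2 := c) = config2 a c"
  by (auto simp: config2_def fun_eq_iff restrict_def)

lemma bass_states_2:
  "bass_states 2 = {config2 0 0, config2 1 0, config2 0 1, config2 1 1}"
proof (intro equalityI subsetI)
  fix x assume "x \<in> bass_states 2"
  then have x: "x \<in> extensional {1..2}" "x 1 \<in> {0, 1}" "x 2 \<in> {0, 1}"
    by (auto simp: bass_states_def PiE_def Pi_def)
  have "x = config2 (x 1) (x 2)"
  proof (rule extensionalityI[OF x(1)])
    fix j :: nat assume "j \<in> {1..2}"
    then have "j = 1 \<or> j = 2" by auto
    then show "x j = config2 (x 1) (x 2) j" by auto
  qed (simp add: config2_def)
  then show "x \<in> {config2 0 0, config2 1 0, config2 0 1, config2 1 1}"
    using x(2,3) by (metis insertE insertI1 insertI2 singletonD)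
qed (auto simp: bass_states_def config2_def split: if_splits)

lemma adoption_rate_2:
  "adoption_rate 2 p q x 1 = p 1 + q 2 1 * real (x 2)"
  "adoption_rate 2 p q x (Suc 0) = p 1 + q 2 1 * real (x 2)"
  "adoption_rate 2 p q x 2 = p 2 + q 1 2 * real (x 1)"
proof -
  have "{1..2} - {1} = {2::nat}" "{1..2} - {2} = {1::nat}" by auto
  then show "adoption_rate 2 p q x 1 = p 1 + q 2 1 * real (x 2)"
    "adoption_rate 2 p q x (Suc 0) = p 1 + q 2 1 * real (x 2)"
    "adoption_rate 2 p q x 2 = p 2 + q 1 2 * real (x 1)"
    by (simp_all add: adoption_rate_def)
qed

lemma bass_generator_2:
  "bass_generator 2 p q x y =
    (if y = x then - ((if x 1 = 0 then adoption_rate 2 p q x 1 else 0)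
                    + (if x 2 = 0 then adoption_rate 2 p q x 2 else 0))
     else (if x 1 = 0 \<and> y = x(1 := 1) then adoption_rate 2 p q x 1 else 0)
        + (if x 2 = 0 \<and> y = x(2 := 1) then adoption_rate 2 p q x 2 else 0))"
proof -
  have "(\<Sum>j | j \<in> {1..2} \<and> P j. f j) = (if P 1 then f 1 else 0) + (if P 2 then f 2 else 0)"
    for P and f :: "nat \<Rightarrow> real"
    unfolding nodes_2 by (subst sum.inter_filter) simp_all
  then show ?thesis by (simp add: bass_generator_def)
qed

section \<open>State probabilities of the two-node model with general rates, which covers both
  networks\<close>

locale bass_model_2 = bass_model \<Omega> 2 p q X
  for \<Omega> :: "'w measure" and p q X
begin

abbreviation P :: "nat \<Rightarrow> nat \<Rightarrow> real \<Rightarrow> real" where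
  "P a b \<equiv> state_prob (config2 a b)"

lemma finite_states: "finite (bass_states 2)"
  by (simp add: bass_states_2)

text \<open>Each jump adds one adopter, so the system is triangular: a configuration with one
  adopter is entered only from \<open>config2 0 0\<close> and is left when the other node
  adopts.\<close>

lemma forward_equations:
  assumes "0 < t"
  shows "(P 0 0 has_real_derivative - (p 1 + p 2) * P 0 0 t) (at t)"
    and "(P 1 0 has_real_derivative p 1 * P 0 0 t - (p 2 + q 1 2) * P 1 0 t) (at t)"
    and "(P 0 1 has_real_derivative p 2 * P 0 0 t - (p 1 + q 2 1) * P 0 1 t) (at t)"
  using forward_equation[OF finite_states assms, of "config2 0 0"]
    forward_equation[OF finite_states assms, of "config2 1 0"]
    forward_equation[OF finite_states assms, of "config2 0 1"]
  by (simp_all add: bass_states_2 bass_generator_2 adoption_rate_2 algebra_simps)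

lemma continuous_P:
  assumes "a \<in> {0, 1}" "b \<in> {0, 1}"
  shows "continuous_on {0..} (P a b)"
  using assms by (intro state_prob_continuous_on finite_states) (auto simp: bass_states_2)

lemma initial_P:
  "P a b 0 = (if a = 0 \<and> b = 0 then 1 else 0)"
proof -
  have ae: "AE \<omega> in \<Omega>. (\<lambda>j\<in>{1..2}. X j 0 \<omega>) = config2 0 0"
    using initially_nonadopters
    by (rule AE_mp) (auto intro!: AE_I2 simp: config2_def fun_eq_iff restrict_def)
  show ?thesis
  proof (cases "a = 0 \<and> b = 0")
    case True
    then show ?thesis
      using ae state_event[of 0 "config2 0 0"]
      by (simp add: state_prob_def bass_states_2 prob_Collect_eq_1 del: One_nat_def)
  next
    case False
    have "AE \<omega> in \<Omega>. \<not> ((\<lambda>j\<in>{1..2}. X j 0 \<omega>) = config2 a b)"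
      using ae by (rule AE_mp) (use False in \<open>auto intro!: AE_I2\<close>)
    \<comment> \<open>An almost surely false predicate has probability 0 whether or not its event is
      measurable, so \<open>a\<close> and \<open>b\<close> may be any natural numbers.\<close>
    then have "state_prob (config2 a b) 0 = 0"
      unfolding state_prob_def by (rule prob_eq_0_AE)
    then show ?thesis using False by simp
  qed
qed

lemma P_0_0: "0 \<le> t \<Longrightarrow> P 0 0 t = exp (- (p 1 + p 2) * t)"
  using linear_ode_homogeneous[OF continuous_P[of 0 0] _ forward_equations(1), of t] initial_P[of 0 0]
  by simp

lemma expected_fraction_eq:
  assumes "0 \<le> t"
  shows "expected_fraction \<Omega> 2 X t = 1 - P 0 0 t - (P 1 0 t + P 0 1 t) / 2"
proof -
  let ?Y = "\<lambda>\<omega>. \<lambda>j\<in>{1..2}. X j t \<omega>"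
  let ?E = "\<lambda>a b. {\<omega> \<in> space \<Omega>. ?Y \<omega> = config2 a b}"
  have ev [measurable]: "?E 0 0 \<in> events" "?E 1 0 \<in> events" "?E 0 1 \<in> events"
    using assms by (auto intro!: state_event simp: bass_states_2 simp del: One_nat_def)
  \<comment> \<open>Counting nonadopters instead, two in \<open>config2 0 0\<close> and one in each
    mixed configuration, avoids the probability of two adopters.\<close>
  have "(\<Sum>j\<in>{1..2}. real (X j t \<omega>)) = 2 - 2 * indicator (?E 0 0) \<omega>
      - indicator (?E 1 0) \<omega> - indicator (?E 0 1) \<omega>" if "\<omega> \<in> space \<Omega>" for \<omega>
  proof -
    have "?Y \<omega> \<in> bass_states 2" using state_in_space[OF assms that] .
    then obtain a b where ab: "?Y \<omega> = config2 a b" "a \<in> {0, 1}" "b \<in> {0, 1}"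
      by (auto simp: bass_states_2)
    have "X 1 t \<omega> = a" "X 2 t \<omega> = b"
      using fun_cong[OF ab(1), of 1] fun_cong[OF ab(1), of 2] by simp_all
    then have "(\<Sum>j\<in>{1..2}. real (X j t \<omega>)) = real a + real b"
      unfolding nodes_2 by simp
    then show ?thesis
      using ab that by (auto simp: indicator_def)
  qed
  then have "expectation (\<lambda>\<omega>. \<Sum>j\<in>{1..2}. real (X j t \<omega>)) =
      expectation (\<lambda>\<omega>. 2 - 2 * indicator (?E 0 0) \<omega>
        - indicator (?E 1 0) \<omega> - indicator (?E 0 1) \<omega>)"
    by (intro Bochner_Integration.integral_cong) auto
  also have "\<dots> = 2 - 2 * prob (?E 0 0) - prob (?E 1 0) - prob (?E 0 1)"
    using ev by (simp add: prob_space emeasure_eq_measure)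
  finally show ?thesis
    by (simp add: expected_fraction_def state_prob_def field_simps del: One_nat_def)
qed

end

section \<open>Comparison of the two networks\<close>

theorem lemma7:
  fixes p q t :: real
    and pA pB :: "nat \<Rightarrow> real"
    and qA qB :: "nat \<Rightarrow> nat \<Rightarrow> real"
    and \<Omega>A :: "'a measure" and XA :: "nat \<Rightarrow> real \<Rightarrow> 'a \<Rightarrow> nat"
    and \<Omega>B :: "'b measure" and XB :: "nat \<Rightarrow> real \<Rightarrow> 'b \<Rightarrow> nat"
  assumes "p > 0" and "q \<ge> 0"
    and "pA 1 = p" and "pA 2 = p" and "qA 1 2 = q" and "qA 2 1 = q"
    and "pB 1 = 2 * p" and "pB 2 = 0" and "qB 2 1 = 0" and "qB 1 2 = 2 * q"
    and "bass_model \<Omega>A 2 pA qA XA"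
    and "bass_model \<Omega>B 2 pB qB XB"
    and "0 < t"
  shows "(q > p \<longrightarrow> expected_fraction \<Omega>B 2 XB t > expected_fraction \<Omega>A 2 XA t) \<and>
         (q = p \<longrightarrow> expected_fraction \<Omega>B 2 XB t = expected_fraction \<Omega>A 2 XA t) \<and>
         (q < p \<longrightarrow> expected_fraction \<Omega>B 2 XB t < expected_fraction \<Omega>A 2 XA t)"
proof -
  interpret A: bass_model_2 \<Omega>A pA qA XA using assms(11) by (simp add: bass_model_2_def)
  interpret B: bass_model_2 \<Omega>B pB qB XB using assms(12) by (simp add: bass_model_2_def)
  define S where "S = (\<lambda>s. A.P 1 0 s + A.P 0 1 s)"
  define R where "R = B.P 1 0"
  define D where "D = (\<lambda>s. S s - R s)"
  \<comment> \<open>In \<open>B\<close> node 2 can adopt only after node 1, since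
    \<open>pB 2 = 0\<close>. The equation for this configuration therefore has no source, and its
    initial value is 0.\<close>
  have B01: "B.P 0 1 t = 0"
    using linear_ode_homogeneous[OF B.continuous_P[of 0 1], of t "2 * p"] B.forward_equations(3)
      B.initial_P[of 0 1] assms by simp
  have P00: "A.P 0 0 s = exp (- 2 * p * s)" "B.P 0 0 s = exp (- 2 * p * s)" if "0 \<le> s" for s
    using A.P_0_0[OF that] B.P_0_0[OF that] assms by simp_all
  \<comment> \<open>By symmetry both mixed configurations of \<open>A\<close> are left at the same
    rate \<open>p + q\<close>, so their sum satisfies a single closed equation.\<close>
  have S': "(S has_real_derivative 2 * p * exp (- 2 * p * s) - (p + q) * S s) (at s)"
    if "0 < s" for s
    using DERIV_add[OF A.forward_equations(2,3)[OF that]] P00[of s] that assms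
    unfolding S_def by (simp add: algebra_simps)
  have R': "(R has_real_derivative 2 * p * exp (- 2 * p * s) - 2 * q * R s) (at s)"
    if "0 < s" for s
    using B.forward_equations(2)[OF that] P00[of s] that assms unfolding R_def by simp
  \<comment> \<open>Writing \<open>2 * q = (p + q) + (q - p)\<close> in the equation for
    \<open>R\<close> gives both rates the common damping \<open>p + q\<close>; the equal sources
    cancel and \<open>(q - p) * R\<close> remains.\<close>
  have D': "(D has_real_derivative (q - p) * R s - (p + q) * D s) (at s)" if "0 < s" for s
    using DERIV_diff[OF S'[OF that] R'[OF that]] unfolding D_def by (simp add: algebra_simps)
  have cont: "continuous_on {0..} R" "continuous_on {0..} D"
    unfolding S_def R_def D_def
    by (intro continuous_intros A.continuous_P B.continuous_P; simp)+
  have init: "R 0 = 0" "D 0 = 0"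
    unfolding S_def R_def D_def by (simp_all add: A.initial_P B.initial_P del: One_nat_def)
  \<comment> \<open>The source \<open>2 * p * exp (- 2 * p * s)\<close> is positive because
    \<open>p > 0\<close>.\<close>
  have R_pos: "0 < R s" if "0 < s" for s
    using linear_ode_pos[OF cont(1) init(1) that R'] assms(1) by simp
  have "0 < D t" if "q > p"
    using linear_ode_pos[OF cont(2) init(2) assms(13) D'] R_pos that by simp
  moreover have "D t = 0" if "q = p"
    using linear_ode_homogeneous[OF cont(2), of t "p + q"] D' init(2) assms(13) that by simp
  moreover have "D t < 0" if "q < p"
  proof -
    \<comment> \<open>Negation makes the source \<open>(p - q) * R s\<close> positive, so the
      positivity lemma applies to \<open>- D\<close>.\<close>
    have "((\<lambda>s. - D s) has_real_derivative (p - q) * R s - (p + q) * (- D s)) (at s)"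
      if "0 < s" for s
      using DERIV_minus[OF D'[OF that]] by (simp add: algebra_simps)
    from linear_ode_pos[OF continuous_on_minus[OF cont(2)] _ assms(13) this]
    show ?thesis using R_pos that init(2) by simp
  qed
  \<comment> \<open>The terms \<open>P 0 0\<close> agree in both networks and cancel. Mass on one
    adopter enters the fraction with factor \<open>- 1 / 2\<close>, so more of it in
    \<open>A\<close> means a larger fraction in \<open>B\<close>.\<close>
  moreover have "expected_fraction \<Omega>B 2 XB t - expected_fraction \<Omega>A 2 XA t = D t / 2"
    using assms(13) A.expected_fraction_eq[of t] B.expected_fraction_eq[of t] P00[of t] B01
    unfolding D_def S_def R_def by (simp add: field_simps)
  ultimately show ?thesis by auto
qed

end
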